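(* Let $V_1,\dots,V_d$ be pre-Hilbert spaces, $\mathbf V={}_a\bigotimes_{j=1}^dV_j$ with the induced scalar product and $\mathbf V_{\|\cdot\|}$ its completion, let $A$ be a densely defined operator generating a flow in $\mathbf V_{\|\cdot\|}$, and let $\mathbf v_0=\lambda_0\bigotimes_{j=1}^dv_0^{(j)}\in\mathcal M_{(1,\dots,1)}(\mathbf V)$ with $\|v_0^{(j)}\|_j=1$ for $1\le j\le d$. The solution $\mathbf v_r(t)=\lambda(t)\bigotimes_{j=1}^dv_j(t)$, with $(v_1(t),\dots,v_d(t))\in\prod_{j=1}^d\mathbb S_{V_j}$, of $$\dot{\mathbf v}_r(t)=\mathcal P_{\mathbf v_r(t)}(A\mathbf v_r(t))\ \text{ for }t\in I,\qquad \mathbf v_r(0)=\mathbf v_0,$$ satisfies $$\langle\dot v_j(t),\dot w_j(t)\rangle_j-\mathrm a_j(t;v_j(t),\dot w_j(t))=0\quad\text{for all }\dot w_j(t)\in\mathbb T_{v_j(t)}(\mathbb S_{V_j}),\ 1\le j\le d,$$ and $$\lambda(t)=\lambda_0\exp\Big(\int_0^t\Big\langle A\Big(\bigotimes_{j=1}^dv_j(s)\Big),\bigotimes_{j=1}^dv_j(s)\Big\rangle ds\Big).$$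
   Context: $\langle\cdot,\cdot\rangle_j$ is the scalar product of the real pre-Hilbert space $V_j$. The induced scalar product on $\mathbf V$ is the bilinear extension of $\langle\bigotimes v^{(j)},\bigotimes w^{(j)}\rangle=\prod_j\langle v^{(j)},w^{(j)}\rangle_j$, with norm $\|\cdot\|$. $\mathcal M_{(1,\dots,1)}(\mathbf V)$ (the Hartree manifold) is the set of nonzero elementary tensors $\lambda\bigotimes_jv_j$. $I=(0,\varepsilon)$ is a time interval. $A$ is a densely defined linear operator in $\mathbf V_{\|\cdot\|}$ with domain $\mathcal D(A)$ generating a flow: there are bijections $\boldsymbol\varphi_t:\mathcal D(A)\to\mathcal D(A)$ with $\boldsymbol\varphi_0=\mathbf{id}$, $\boldsymbol\varphi_{t+s}=\boldsymbol\varphi_t\circ\boldsymbol\varphi_s$, and for $\mathbf u_0\in\mathcal D(A)$ the curve $\mathbf u(t)=\boldsymbol\varphi_t(\mathbf u_0)$ is differentiable in $\mathbf V_{\|\cdot\|}$ with $\dot{\mathbf u}=A\mathbf u$, $\mathbf u(0)=\mathbf u_0$. $\mathbb S_{V_j}=\{x\in V_j:\|x\|_j=1\}$ and $\mathbb T_x(\mathbb S_{V_j})=\{w\in V_j:\langle x,w\rangle_j=0\}$. The curve $\mathbf v_r$ is a $\mathcal C^1$ curve in the Hartree manifold with $\lambda\in\mathcal C^1(I,\mathbb R)$, $v_j\in\mathcal C^1(I,V_j)$. The tangent space of the Hartree manifold at $\mathbf v=\lambda\bigotimes_jv_j$ ($v_j\in\mathbb S_{V_j}$), viewed in the ambient space,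 consists of the vectors $\dot{\mathbf w}=\dot\beta\bigotimes_jv_j+\lambda\sum_j\dot w_j\otimes\bigotimes_{k\ne j}v_k$ with $\dot\beta\in\mathbb R$, $\dot w_j\in\mathbb T_{v_j}(\mathbb S_{V_j})$. $\mathcal P_{\mathbf v}$ is the orthogonal (metric) projection onto it, so the equation means $\langle\dot{\mathbf v}_r(t)-A\mathbf v_r(t),\dot{\mathbf w}\rangle=0$ for all tangent vectors $\dot{\mathbf w}$ at $\mathbf v_r(t)$, with $\dot{\mathbf v}_r(t)$ tangent. The time-dependent bilinear forms $\mathrm a_k(t;\cdot,\cdot):V_k\times V_k\to\mathbb R$ are $\mathrm a_k(t;z_k,y_k)=\big\langle A\big(z_k\otimes\bigotimes_{j\ne k}v_j(t)\big),\,y_k\otimes\bigotimes_{j\neq k}v_j(t)\big\rangle$. *)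

theory Defs
  imports "HOL-Analysis.Analysis"
begin

text \<open>
  The pre-Hilbert spaces \<open>V j\<close>, for \<open>j\<close> in the finite index type \<open>'d\<close>, are linear subspaces
  of one real inner product space \<open>'a\<close>. This is no restriction, since any family of pre-Hilbert
  spaces embeds isometrically into its orthogonal direct sum. The subspaces need be neither closed,
  nor orthogonal, nor distinct.
\<close>

definition multilinear_on :: "('d \<Rightarrow> 'a::real_vector set) \<Rightarrow> (('d \<Rightarrow> 'a) \<Rightarrow> 'b::real_vector) \<Rightarrow> bool"
  where "multilinear_on V m \<longleftrightarrow>
    (\<forall>v k x y. (\<forall>j. v j \<in> V j) \<longrightarrow> x \<in> V k \<longrightarrow> y \<in> V k \<longrightarrow>
       m (v(k := x + y)) = m (v(k := x)) + m (v(k := y))) \<and>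
    (\<forall>v k c x. (\<forall>j. v j \<in> V j) \<longrightarrow> x \<in> V k \<longrightarrow>
       m (v(k := c *\<^sub>R x)) = c *\<^sub>R m (v(k := x)))"

text \<open>
  \<open>T v\<close> is the elementary tensor \<open>\<Otimes>\<^sub>j v j\<close>. The universal property makes
  \<open>span (T ` {v. \<forall>j. v j \<in> V j})\<close> the algebraic tensor product of the \<open>V j\<close>. Real-valued
  test maps suffice, because linear functionals separate points. That \<open>l\<close> is linear on all
  of \<open>'b\<close> rather than on the span costs nothing: linear maps on a subspace extend.
\<close>

definition algebraic_tensor_product ::
    "('d \<Rightarrow> 'a::real_vector set) \<Rightarrow> (('d \<Rightarrow> 'a) \<Rightarrow> 'b::real_vector) \<Rightarrow> bool"
  where "algebraic_tensor_product V T \<longleftrightarrow>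
    multilinear_on V T \<and>
    (\<forall>m :: ('d \<Rightarrow> 'a) \<Rightarrow> real. multilinear_on V m \<longrightarrow>
       (\<exists>l :: 'b \<Rightarrow> real. linear l \<and> (\<forall>v. (\<forall>j. v j \<in> V j) \<longrightarrow> l (T v) = m v)))"

text \<open>The whole type \<open>'h\<close> is the completion of the algebraic tensor product.\<close>

definition hilbert_tensor_product ::
    "('d::finite \<Rightarrow> 'a::real_inner set) \<Rightarrow>
     (('d \<Rightarrow> 'a) \<Rightarrow> 'h::{real_inner, complete_space}) \<Rightarrow> bool"
  where "hilbert_tensor_product V T \<longleftrightarrow>
    (\<forall>j. subspace (V j)) \<and>
    algebraic_tensor_product V T \<and>
    (\<forall>v w. (\<forall>j. v j \<in> V j) \<longrightarrow> (\<forall>j. w j \<in> V j) \<longrightarrow>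
       inner (T v) (T w) = (\<Prod>j\<in>UNIV. inner (v j) (w j))) \<and>
    closure (span (T ` {v. \<forall>j. v j \<in> V j})) = UNIV"

text \<open>An unbounded operator is a total function \<open>A\<close> with a domain \<open>D\<close>;
  its values outside \<open>D\<close> are irrelevant.\<close>

definition densely_defined_operator :: "'h::real_normed_vector set \<Rightarrow> ('h \<Rightarrow> 'h) \<Rightarrow> bool"
  where "densely_defined_operator D A \<longleftrightarrow>
    subspace D \<and> closure D = UNIV \<and>
    (\<forall>x\<in>D. \<forall>y\<in>D. A (x + y) = A x + A y) \<and>
    (\<forall>c. \<forall>x\<in>D. A (c *\<^sub>R x) = c *\<^sub>R A x)"

definition generates_flow :: "'h::real_normed_vector set \<Rightarrow> ('h \<Rightarrow> 'h) \<Rightarrow> bool"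
  where "generates_flow D A \<longleftrightarrow>
    (\<exists>\<phi> :: real \<Rightarrow> 'h \<Rightarrow> 'h.
       (\<forall>t. bij_betw (\<phi> t) D D) \<and>
       (\<forall>u\<in>D. \<phi> 0 u = u) \<and>
       (\<forall>s t. \<forall>u\<in>D. \<phi> (t + s) u = \<phi> t (\<phi> s u)) \<and>
       (\<forall>u\<in>D. \<forall>t. ((\<lambda>t. \<phi> t u) has_vector_derivative A (\<phi> t u)) (at t)))"

definition hartree_manifold ::
    "('d \<Rightarrow> 'a set) \<Rightarrow> (('d \<Rightarrow> 'a) \<Rightarrow> 'h::real_vector) \<Rightarrow> 'h set"
  where "hartree_manifold V T = {c *\<^sub>R T v | c v. \<forall>j. v j \<in> V j} - {0}"

definition unit_sphere :: "'a::real_normed_vector set \<Rightarrow> 'a set"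
  where "unit_sphere X = {x \<in> X. norm x = 1}"

definition sphere_tangent :: "'a::real_inner set \<Rightarrow> 'a \<Rightarrow> 'a set"
  where "sphere_tangent X x = {w \<in> X. inner x w = 0}"

text \<open>The tangent space at \<open>c *\<^sub>R T v\<close>, where all \<open>v j\<close> are unit vectors.\<close>

definition hartree_tangent ::
    "('d::finite \<Rightarrow> 'a::real_inner set) \<Rightarrow> (('d \<Rightarrow> 'a) \<Rightarrow> 'h::real_vector) \<Rightarrow>
     real \<Rightarrow> ('d \<Rightarrow> 'a) \<Rightarrow> 'h set"
  where "hartree_tangent V T c v =
    {b *\<^sub>R T v + c *\<^sub>R (\<Sum>j\<in>UNIV. T (v(j := w j))) | b w.
       \<forall>j. w j \<in> sphere_tangent (V j) (v j)}"

text \<open>A relation rather than a function: the tangent spaces need not be closed in \<open>'h\<close>, so a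
  projection of a given vector need not exist. The projection is unique on a subspace.\<close>

definition is_orthogonal_projection :: "'h::real_inner set \<Rightarrow> 'h \<Rightarrow> 'h \<Rightarrow> bool"
  where "is_orthogonal_projection S x p \<longleftrightarrow> p \<in> S \<and> (\<forall>w\<in>S. inner (p - x) w = 0)"

text \<open>\<open>C\<^sup>1\<close> in the space \<open>X\<close> itself: for a subspace \<open>X\<close> that is not closed, the limit of the
  difference quotients taken in \<open>'a\<close> has to lie in \<open>X\<close>.\<close>

definition C1_curve_in :: "'a::real_normed_vector set \<Rightarrow> real set \<Rightarrow> (real \<Rightarrow> 'a) \<Rightarrow> bool"
  where "C1_curve_in X I c \<longleftrightarrow>
    c C1_differentiable_on I \<and> (\<forall>t\<in>I. c t \<in> X \<and> vector_derivative c (at t) \<in> X)"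

definition bilinear_form_a ::
    "('h::real_inner \<Rightarrow> 'h) \<Rightarrow> (('d \<Rightarrow> 'a) \<Rightarrow> 'h) \<Rightarrow> ('d \<Rightarrow> real \<Rightarrow> 'a) \<Rightarrow>
     'd \<Rightarrow> real \<Rightarrow> 'a \<Rightarrow> 'a \<Rightarrow> real"
  where "bilinear_form_a A T v k t z y =
    inner (A (T ((\<lambda>j. v j t)(k := z)))) (T ((\<lambda>j. v j t)(k := y)))"

end

theory Submission
  imports Defs
begin

text \<open>
  Write the solution as \<open>l *\<^sub>R T u\<close>, with all \<open>u j\<close> unit vectors. By the product rule for the tensor
  map (\<open>has_vector_derivative_tensor\<close>), its velocity is \<open>l'\<close> times \<open>T u\<close>, plus \<open>l\<close> times the sum
  over \<open>j\<close> of the tensors in which \<open>u' j\<close> replaces \<open>u j\<close>. The curves stay on the spheres, so every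
  \<open>u' j\<close> is orthogonal to \<open>u j\<close>. Since inner products of elementary tensors are products, all these
  summands are pairwise orthogonal (\<open>inner_velocity\<close>).

  The projected equation says that the velocity and \<open>A (l *\<^sub>R T u)\<close> have the same inner product with
  every tangent vector. Two kinds of tangent vectors decouple it. Testing with \<open>T u\<close> leaves
  \<open>l' = l * inner (A (T u)) (T u)\<close>. Testing with \<open>l *\<^sub>R T (u(k := w))\<close>, where \<open>w\<close> is orthogonal to
  \<open>u k\<close>, leaves the equation for \<open>u k\<close>, multiplied by the nonzero number \<open>l\<^sup>2\<close>.

  The scalar equation then integrates to the exponential formula
  (\<open>nonvanishing_solution_eq_exp_integral\<close>). The coefficient \<open>inner (A (T u)) (T u)\<close> is the
  logarithmic derivative of \<open>l\<close>, so its integral exists even if \<open>A\<close> is unbounded.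
\<close>

section \<open>Difference quotients and multilinear maps\<close>

lemma has_vector_derivative_quotient_iff:
  "(f has_vector_derivative f') (at t) \<longleftrightarrow>
    ((\<lambda>s. (f s - f t) /\<^sub>R (s - t)) \<longlongrightarrow> f') (at t)"
proof -
  have "norm ((f s - f t) - (s - t) *\<^sub>R f') / norm (s - t) = norm ((f s - f t) /\<^sub>R (s - t) - f')"
    if "s \<noteq> t" for s
  proof -
    have "(f s - f t) /\<^sub>R (s - t) - f' = ((f s - f t) - (s - t) *\<^sub>R f') /\<^sub>R (s - t)"
      using that by (simp add: scaleR_diff_right)
    then show ?thesis
      by (simp add: divide_inverse abs_inverse mult.commute)
  qed
  then have "((\<lambda>s. norm ((f s - f t) - (s - t) *\<^sub>R f') / norm (s - t)) \<longlongrightarrow> 0) (at t) \<longleftrightarrow>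
      ((\<lambda>s. norm ((f s - f t) /\<^sub>R (s - t) - f')) \<longlongrightarrow> 0) (at t)"
    by (intro tendsto_cong) (auto simp: eventually_at_filter)
  then show ?thesis
    by (simp add: has_vector_derivative_def has_derivative_iff_norm bounded_linear_scaleR_left
        tendsto_norm_zero_iff LIM_zero_iff)
qed

lemma multilinear_on_diff:
  assumes "multilinear_on V m" and "\<forall>j. subspace (V j)" and "\<forall>j. v j \<in> V j"
    and "x \<in> V k" and "y \<in> V k"
  shows "m (v(k := x - y)) = m (v(k := x)) - m (v(k := y))"
proof -
  have "x - y \<in> V k"
    using assms by (simp add: subspace_diff)
  then have "m (v(k := (x - y) + y)) = m (v(k := x - y)) + m (v(k := y))"
    using assms unfolding multilinear_on_def by blast
  then show ?thesis by simp
qed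

lemma multilinear_on_scale:
  assumes "multilinear_on V m" and "\<forall>j. v j \<in> V j" and "x \<in> V k"
  shows "m (v(k := c *\<^sub>R x)) = c *\<^sub>R m (v(k := x))"
  using assms unfolding multilinear_on_def by blast

lemma multilinear_on_zero:
  assumes "multilinear_on V m" and "\<forall>j. v j \<in> V j"
  shows "m (v(k := 0)) = 0"
  using multilinear_on_scale[OF assms, of "v k" k 0] assms(2) by simp

section \<open>Elementary tensors: inner products, continuity, product rule\<close>

context
  fixes V :: "'d::finite \<Rightarrow> 'a::real_inner set"
    and T :: "('d \<Rightarrow> 'a) \<Rightarrow> 'h::{real_inner, complete_space}"
  assumes tensor: "hilbert_tensor_product V T"
begin

lemma tensor_subspace: "subspace (V j)"
  using tensor unfolding hilbert_tensor_product_def by blast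

lemma tensor_multilinear: "multilinear_on V T"
  using tensor unfolding hilbert_tensor_product_def algebraic_tensor_product_def by blast

lemma inner_tensor:
  assumes "\<forall>j. v j \<in> V j" and "\<forall>j. w j \<in> V j"
  shows "inner (T v) (T w) = (\<Prod>j\<in>UNIV. inner (v j) (w j))"
  using tensor assms unfolding hilbert_tensor_product_def by blast

lemma inner_tensor_eq_0:
  assumes "\<forall>j. v j \<in> V j" and "\<forall>j. w j \<in> V j" and "inner (v k) (w k) = 0"
  shows "inner (T v) (T w) = 0"
  unfolding inner_tensor[OF assms(1,2)] using assms(3) by (intro prod_zero) auto

lemma inner_tensor_unit:
  assumes "\<forall>j. v j \<in> V j" and "\<forall>j. norm (v j) = 1" and "x \<in> V k" and "y \<in> V k"
  shows "inner (T (v(k := x))) (T (v(k := y))) = inner x y"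
proof -
  have "inner (T (v(k := x))) (T (v(k := y)))
      = (\<Prod>j\<in>UNIV. inner ((v(k := x)) j) ((v(k := y)) j))"
    using assms by (intro inner_tensor) auto
  also have "\<dots> = (\<Prod>j\<in>UNIV. if j = k then inner x y else 1)"
    using assms(2) by (intro prod.cong refl) (simp add: dot_square_norm)
  finally show ?thesis by simp
qed

text \<open>Joint continuity of the tensor map needs no operator norm of a multilinear map: expanding
  the square of \<open>norm (T f - T b)\<close> leaves three products of scalar inner products, all of which
  tend to the squared norm of \<open>T b\<close>.\<close>

lemma tendsto_tensor:
  assumes ev: "\<forall>j. \<forall>\<^sub>F s in F. f j s \<in> V j"
    and lim: "\<forall>j. (f j \<longlongrightarrow> b j) F"
    and b: "\<forall>j. b j \<in> V j"
  shows "((\<lambda>s. T (\<lambda>j. f j s)) \<longlongrightarrow> T b) F"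
proof -
  let ?N = "\<lambda>s. (\<Prod>j\<in>UNIV. inner (f j s) (f j s)) - 2 * (\<Prod>j\<in>UNIV. inner (f j s) (b j))
      + (\<Prod>j\<in>UNIV. inner (b j) (b j))"
  have "(?N \<longlongrightarrow> (\<Prod>j\<in>UNIV. inner (b j) (b j)) - 2 * (\<Prod>j\<in>UNIV. inner (b j) (b j))
      + (\<Prod>j\<in>UNIV. inner (b j) (b j))) F"
    by (intro tendsto_intros lim[rule_format])
  then have "(?N \<longlongrightarrow> 0) F" by simp
  moreover have "\<forall>\<^sub>F s in F. \<forall>j. f j s \<in> V j"
    using ev by (simp add: eventually_all_finite)
  then have "\<forall>\<^sub>F s in F. ?N s = (norm (T (\<lambda>j. f j s) - T b))\<^sup>2"
  proof eventually_elim
    case (elim s)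
    have "(norm (T (\<lambda>j. f j s) - T b))\<^sup>2
        = inner (T (\<lambda>j. f j s)) (T (\<lambda>j. f j s)) - 2 * inner (T (\<lambda>j. f j s)) (T b) + inner (T b) (T b)"
      unfolding power2_norm_eq_inner inner_diff_left inner_diff_right
      using inner_commute[of "T b" "T (\<lambda>j. f j s)"] by linarith
    then show ?case
      using elim b by (simp add: inner_tensor)
  qed
  ultimately have "((\<lambda>s. (norm (T (\<lambda>j. f j s) - T b))\<^sup>2) \<longlongrightarrow> 0) F"
    using tendsto_cong by force
  then have "((\<lambda>s. norm (T (\<lambda>j. f j s) - T b)) \<longlongrightarrow> 0) F"
    using tendsto_real_sqrt by fastforce
  then show ?thesis
    by (metis tendsto_norm_zero_iff LIM_zero_iff)
qed

text \<open>The product rule, obtained by letting one factor after another move: the set \<open>S\<close> collects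
  the factors that already run along their curves. When \<open>k\<close> joins \<open>S\<close>, multilinearity puts the
  difference quotient of \<open>v k\<close> into the slot \<open>k\<close>, and continuity of the tensor map gives the limit.
  The membership of \<open>v' k\<close> in \<open>V k\<close> enters in that limit.\<close>

lemma has_vector_derivative_tensor:
  assumes ev: "\<forall>j. \<forall>\<^sub>F s in at t. v j s \<in> V j"
    and vt: "\<forall>j. v j t \<in> V j"
    and deriv: "\<forall>j. (v j has_vector_derivative v' j) (at t)"
    and v': "\<forall>j. v' j \<in> V j"
  shows "((\<lambda>s. T (\<lambda>j. v j s)) has_vector_derivative
          (\<Sum>k\<in>UNIV. T ((\<lambda>j. v j t)(k := v' k)))) (at t)"
proof -
  have quot: "((\<lambda>s. (v j s - v j t) /\<^sub>R (s - t)) \<longlongrightarrow> v' j) (at t)" for j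
    using deriv has_vector_derivative_quotient_iff by blast
  have cont: "(v j \<longlongrightarrow> v j t) (at t)" for j
    using deriv has_vector_derivative_continuous continuous_within by blast
  have ev': "\<forall>\<^sub>F s in at t. \<forall>j. v j s \<in> V j"
    using ev by (simp add: eventually_all_finite)
  define x where "x S s = (\<lambda>j. if j \<in> S then v j s else v j t)" for S s
  have "((\<lambda>s. (T (x S s) - T (\<lambda>j. v j t)) /\<^sub>R (s - t)) \<longlongrightarrow>
      (\<Sum>k\<in>S. T ((\<lambda>j. v j t)(k := v' k)))) (at t)" if "finite S" for S
    using that
  proof (induction S)
    case empty
    then show ?case by (simp add: x_def)
  next
    case (insert k S)
    let ?q = "\<lambda>s. (v k s - v k t) /\<^sub>R (s - t)"
    have evq: "\<forall>\<^sub>F s in at t. \<forall>j. ((x S s)(k := ?q s)) j \<in> V j"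
      using ev'
      by eventually_elim (use vt in \<open>auto simp: x_def intro!: subspace_scale subspace_diff tensor_subspace\<close>)
    have "((\<lambda>s. T (\<lambda>j. ((x S s)(k := ?q s)) j)) \<longlongrightarrow> T ((\<lambda>j. v j t)(k := v' k))) (at t)"
    proof (rule tendsto_tensor)
      show "\<forall>j. \<forall>\<^sub>F s in at t. ((x S s)(k := ?q s)) j \<in> V j"
        by (intro allI eventually_mono[OF evq]) (erule spec)
      show "\<forall>j. ((\<lambda>s. ((x S s)(k := ?q s)) j) \<longlongrightarrow> ((\<lambda>j. v j t)(k := v' k)) j) (at t)"
      proof
        fix j
        have "((\<lambda>s. x S s j) \<longlongrightarrow> v j t) (at t)"
          using cont by (cases "j \<in> S") (simp_all add: x_def)
        then show "((\<lambda>s. ((x S s)(k := ?q s)) j) \<longlongrightarrow> ((\<lambda>j. v j t)(k := v' k)) j) (at t)"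
          using quot by (cases "j = k") simp_all
      qed
      show "\<forall>j. ((\<lambda>j. v j t)(k := v' k)) j \<in> V j"
        using vt v' by simp
    qed
    then have "((\<lambda>s. (T (x S s) - T (\<lambda>j. v j t)) /\<^sub>R (s - t) + T ((x S s)(k := ?q s))) \<longlongrightarrow>
        (\<Sum>k\<in>S. T ((\<lambda>j. v j t)(k := v' k))) + T ((\<lambda>j. v j t)(k := v' k))) (at t)"
      by (rule tendsto_add[OF insert.IH])
    moreover have "\<forall>\<^sub>F s in at t. (T (x S s) - T (\<lambda>j. v j t)) /\<^sub>R (s - t) + T ((x S s)(k := ?q s))
        = (T (x (insert k S) s) - T (\<lambda>j. v j t)) /\<^sub>R (s - t)"
      using ev'
    proof eventually_elim
      case (elim s)
      have xS: "\<forall>j. x S s j \<in> V j"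
        using elim vt by (simp add: x_def)
      have upd: "(x S s)(k := v k s) = x (insert k S) s" "(x S s)(k := v k t) = x S s"
        using insert.hyps by (auto simp: x_def)
      have "T ((x S s)(k := ?q s)) = (T ((x S s)(k := v k s)) - T ((x S s)(k := v k t))) /\<^sub>R (s - t)"
        using elim vt xS tensor_subspace tensor_multilinear
        by (simp add: multilinear_on_scale multilinear_on_diff subspace_diff)
      then show ?case
        by (simp add: upd scaleR_add_right[symmetric])
    qed
    ultimately have "((\<lambda>s. (T (x (insert k S) s) - T (\<lambda>j. v j t)) /\<^sub>R (s - t)) \<longlongrightarrow>
        (\<Sum>k\<in>S. T ((\<lambda>j. v j t)(k := v' k))) + T ((\<lambda>j. v j t)(k := v' k))) (at t)"
      by (rule Lim_transform_eventually)
    then show ?case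
      unfolding sum.insert[OF insert.hyps] by (simp only: add.commute)
  qed
  from this[of UNIV] show ?thesis
    unfolding has_vector_derivative_quotient_iff by (simp add: x_def)
qed

section \<open>Velocities and tangent vectors of the Hartree manifold\<close>

text \<open>The velocity of \<open>l *\<^sub>R T u\<close> splits into orthogonal parts, one along \<open>T u\<close> and one for each
  slot. Testing with \<open>T u\<close> or with a tensor that varies in one slot only therefore isolates a single
  unknown.\<close>

lemma inner_velocity:
  fixes u u' :: "'d \<Rightarrow> 'a" and l l' :: real
  assumes u: "\<forall>j. u j \<in> unit_sphere (V j)"
    and u': "\<forall>j. u' j \<in> sphere_tangent (V j) (u j)"
  defines "p \<equiv> l' *\<^sub>R T u + l *\<^sub>R (\<Sum>j\<in>UNIV. T (u(j := u' j)))"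
  shows "inner p (T u) = l'"
    and "w \<in> sphere_tangent (V k) (u k) \<Longrightarrow> inner p (T (u(k := w))) = l * inner (u' k) w"
proof -
  have uV: "\<forall>j. u j \<in> V j" and un: "\<forall>j. norm (u j) = 1"
    using u by (auto simp: unit_sphere_def)
  have u'V: "u' j \<in> V j" "inner (u j) (u' j) = 0" "inner (u' j) (u j) = 0" for j
    using u' by (auto simp: sphere_tangent_def inner_commute)
  have "inner (T u) (T u) = 1"
    using inner_tensor_unit[OF uV un, of "u k" k "u k" for k] uV un by (simp add: dot_square_norm)
  moreover have "inner (T (u(j := u' j))) (T u) = 0" for j
    using uV u'V by (intro inner_tensor_eq_0[where k = j]) auto
  ultimately show "inner p (T u) = l'"
    by (simp add: p_def inner_add_left inner_sum_left)
  assume w: "w \<in> sphere_tangent (V k) (u k)"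
  then have wV: "w \<in> V k" "inner (u k) w = 0"
    by (auto simp: sphere_tangent_def)
  have "inner (T u) (T (u(k := w))) = 0"
    using uV wV by (intro inner_tensor_eq_0[where k = k]) auto
  moreover have "inner (T (u(j := u' j))) (T (u(k := w))) = (if j = k then inner (u' k) w else 0)" for j
  proof (cases "j = k")
    case True
    then show ?thesis
      using inner_tensor_unit[OF uV un u'V(1) wV(1)] by simp
  next
    case False
    then show ?thesis
      using uV u'V wV by (simp, intro inner_tensor_eq_0[where k = k]) auto
  qed
  ultimately show "inner p (T (u(k := w))) = l * inner (u' k) w"
    by (simp add: p_def inner_add_left inner_sum_left)
qed

lemma tensor_in_hartree_tangent:
  assumes "\<forall>j. u j \<in> V j"
  shows "T u \<in> hartree_tangent V T l u"
    and "w \<in> sphere_tangent (V k) (u k) \<Longrightarrow> l *\<^sub>R T (u(k := w)) \<in> hartree_tangent V T l u"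
proof -
  have 0: "0 \<in> sphere_tangent (V j) (u j)" for j
    by (simp add: sphere_tangent_def subspace_0 tensor_subspace)
  have T0: "T (u(j := 0)) = 0" for j
    using multilinear_on_zero[OF tensor_multilinear assms] .
  have "T u = 1 *\<^sub>R T u + l *\<^sub>R (\<Sum>j\<in>UNIV. T (u(j := (\<lambda>_. 0) j)))"
    by (simp add: T0)
  then show "T u \<in> hartree_tangent V T l u"
    unfolding hartree_tangent_def using 0
    by (intro CollectI exI[of _ 1] exI[of _ "\<lambda>_. 0"] conjI) simp_all
  assume w: "w \<in> sphere_tangent (V k) (u k)"
  have "(\<Sum>j\<in>UNIV. T (u(j := ((\<lambda>_. 0)(k := w)) j)))
      = (\<Sum>j\<in>UNIV. if j = k then T (u(k := w)) else 0)"
    by (intro sum.cong) (auto simp: T0)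
  then have "l *\<^sub>R T (u(k := w))
      = 0 *\<^sub>R T u + l *\<^sub>R (\<Sum>j\<in>UNIV. T (u(j := ((\<lambda>_. 0)(k := w)) j)))"
    by simp
  moreover have "\<forall>j. ((\<lambda>_. 0)(k := w)) j \<in> sphere_tangent (V j) (u j)"
    using 0 w by simp
  ultimately show "l *\<^sub>R T (u(k := w)) \<in> hartree_tangent V T l u"
    unfolding hartree_tangent_def
    by (intro CollectI exI[of _ 0] exI[of _ "(\<lambda>_. 0)(k := w)"] conjI)
qed

end

section \<open>Curves on spheres and the scalar equation\<close>

lemma derivative_orthogonal_of_constant_norm:
  fixes c :: "real \<Rightarrow> 'a::real_inner"
  assumes "(c has_vector_derivative c') (at t)" and "\<forall>\<^sub>F s in nhds t. norm (c s) = r"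
  shows "inner (c t) c' = 0"
proof -
  have "((\<lambda>s. inner (c s) (c s)) has_real_derivative inner (c t) c' + inner c' (c t)) (at t)"
    using assms(1)
    by (auto simp: has_vector_derivative_def has_field_derivative_def algebra_simps
        intro!: derivative_eq_intros)
  moreover have "((\<lambda>s. inner (c s) (c s)) has_real_derivative 0) (at t)"
  proof (subst DERIV_cong_ev[OF refl _ refl])
    show "\<forall>\<^sub>F s in nhds t. inner (c s) (c s) = r\<^sup>2"
      using assms(2) by eventually_elim (simp add: dot_square_norm)
  qed simp
  ultimately show ?thesis
    using DERIV_unique by (fastforce simp: inner_commute)
qed

text \<open>The derivative is prescribed only at the interior points, and \<open>a\<close> may be
  unbounded near \<open>0\<close>. The quotient by the initial value stays positive by the intermediate value
  theorem, so its logarithm is a primitive of \<open>a\<close> that is continuous up to \<open>0\<close>; this yields the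
  integrability of \<open>a\<close> along with the value of its integral.\<close>

lemma nonvanishing_solution_eq_exp_integral:
  fixes y a :: "real \<Rightarrow> real"
  assumes t: "0 \<le> t"
    and cont: "continuous_on {0..t} y"
    and nz: "\<forall>s\<in>{0..t}. y s \<noteq> 0"
    and ode: "\<forall>s\<in>{0<..<t}. (y has_real_derivative a s * y s) (at s)"
  shows "a integrable_on {0..t}" and "y t = y 0 * exp (integral {0..t} a)"
proof -
  have pos: "0 < y s / y 0" if s: "s \<in> {0..t}" for s
  proof (rule ccontr)
    assume "\<not> 0 < y s / y 0"
    moreover have "continuous_on {0..s} (\<lambda>s. y s / y 0)"
      using s nz t by (intro continuous_intros continuous_on_subset[OF cont]) auto
    moreover have "y 0 / y 0 = 1"
      using nz t by simp
    ultimately obtain r where "0 \<le> r" "r \<le> s" "y r / y 0 = 0"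
      using IVT2'[of "\<lambda>s. y s / y 0" s 0 0] s by fastforce
    then show False
      using nz s t by auto
  qed
  let ?L = "\<lambda>s. ln (y s / y 0)"
  have "(a has_integral (?L t - ?L 0)) {0..t}"
  proof (rule fundamental_theorem_of_calculus_interior[OF t])
    show "continuous_on {0..t} ?L"
      using nz t pos by (intro continuous_intros cont) force+
    show "(?L has_vector_derivative a s) (at s)" if s: "s \<in> {0<..<t}" for s
    proof -
      have "y s \<noteq> 0" "y 0 \<noteq> 0" "0 < y s / y 0"
        using nz pos[of s] s by auto
      then have "(?L has_real_derivative a s) (at s)"
        using ode s by (auto intro!: derivative_eq_intros simp: field_simps)
      then show ?thesis
        by (simp add: has_real_derivative_iff_has_vector_derivative)
    qed
  qed
  moreover have "?L 0 = 0"
    using nz t by simp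
  ultimately have int: "(a has_integral ?L t) {0..t}"
    by simp
  then show "a integrable_on {0..t}"
    by blast
  have "exp (?L t) = y t / y 0"
    using pos[of t] t by simp
  then show "y t = y 0 * exp (integral {0..t} a)"
    using integral_unique[OF int] nz t by simp
qed

section \<open>The projected equation in the factors\<close>

theorem theorem5p6:
  fixes V :: "'d::finite \<Rightarrow> 'a::real_inner set"
    and T :: "('d \<Rightarrow> 'a) \<Rightarrow> 'h::{real_inner, complete_space}"
    and D :: "'h set" and A :: "'h \<Rightarrow> 'h"
    and lam0 :: real and v0 :: "'d \<Rightarrow> 'a"
    and \<epsilon> :: real
    and lam :: "real \<Rightarrow> real" and v :: "'d \<Rightarrow> real \<Rightarrow> 'a" and v_r :: "real \<Rightarrow> 'h"
  assumes "hilbert_tensor_product V T"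
    and "densely_defined_operator D A"
    and "generates_flow D A"
    and "\<forall>j. v0 j \<in> unit_sphere (V j)"
    and "lam0 *\<^sub>R T v0 \<in> hartree_manifold V T"
    and "0 < \<epsilon>"
    and "\<forall>t\<in>{0..<\<epsilon>}. v_r t = lam t *\<^sub>R T (\<lambda>j. v j t)"
    and "\<forall>t\<in>{0..<\<epsilon>}. \<forall>j. v j t \<in> unit_sphere (V j)"
    and "lam C1_differentiable_on {0<..<\<epsilon>}"
    and "\<forall>j. C1_curve_in (V j) {0<..<\<epsilon>} (v j)"
    and "continuous_on {0..<\<epsilon>} lam"
    and "continuous_on {0..<\<epsilon>} v_r"
    and "\<forall>t\<in>{0<..<\<epsilon>}. v_r t \<in> hartree_manifold V T \<inter> D"
    and "\<forall>t\<in>{0<..<\<epsilon>}. is_orthogonal_projection (hartree_tangent V T (lam t) (\<lambda>j. v j t))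
           (A (v_r t)) (vector_derivative v_r (at t))"
    and "v_r 0 = lam0 *\<^sub>R T v0"
    and "lam 0 = lam0"
  shows "(\<forall>t\<in>{0<..<\<epsilon>}. \<forall>j. \<forall>w\<in>sphere_tangent (V j) (v j t).
            inner (vector_derivative (v j) (at t)) w - bilinear_form_a A T v j t (v j t) w = 0) \<and>
         (\<forall>t\<in>{0..<\<epsilon>}.
            (\<lambda>s. inner (A (T (\<lambda>j. v j s))) (T (\<lambda>j. v j s))) integrable_on {0..t} \<and>
            lam t = lam0 * exp (integral {0..t}
              (\<lambda>s. inner (A (T (\<lambda>j. v j s))) (T (\<lambda>j. v j s)))))"
proof -
  note tensor = assms(1)
  have unit: "v j s \<in> unit_sphere (V j)" if "s \<in> {0..<\<epsilon>}" for j s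
    using assms(8) that by blast
  have lam0: "lam 0 \<noteq> 0"
    using assms(5,16) by (auto simp: hartree_manifold_def)
  let ?a = "\<lambda>s. inner (A (T (\<lambda>j. v j s))) (T (\<lambda>j. v j s))"
  have "lam t \<noteq> 0 \<and> (lam has_real_derivative ?a t * lam t) (at t) \<and>
      (\<forall>k. \<forall>w\<in>sphere_tangent (V k) (v k t).
         inner (vector_derivative (v k) (at t)) w - bilinear_form_a A T v k t (v k t) w = 0)"
    if t: "t \<in> {0<..<\<epsilon>}" for t
  proof -
    let ?u = "\<lambda>j. v j t"
    let ?u' = "\<lambda>j. vector_derivative (v j) (at t)"
    let ?l' = "vector_derivative lam (at t)"
    let ?p = "?l' *\<^sub>R T ?u + lam t *\<^sub>R (\<Sum>j\<in>UNIV. T (?u(j := ?u' j)))"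
    have near: "\<forall>\<^sub>F s in nhds t. s \<in> {0<..<\<epsilon>}"
      using t by (intro eventually_nhds_in_open) auto
    have u: "\<forall>j. ?u j \<in> unit_sphere (V j)" and uV: "\<forall>j. ?u j \<in> V j"
      using unit t by (auto simp: unit_sphere_def)
    have vr: "v_r t = lam t *\<^sub>R T ?u"
      using assms(7) t by simp
    have l: "lam t \<noteq> 0"
      using assms(13) t vr by (auto simp: hartree_manifold_def)
    have dv: "\<forall>j. (v j has_vector_derivative ?u' j) (at t)"
      using assms(10) t by (auto simp: C1_curve_in_def C1_differentiable_on_eq vector_derivative_works)
    have dl: "(lam has_vector_derivative ?l') (at t)"
      using assms(9) t by (auto simp: C1_differentiable_on_eq vector_derivative_works)
    have u'V: "\<forall>j. ?u' j \<in> V j"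
      using assms(10) t by (auto simp: C1_curve_in_def)
    have u': "\<forall>j. ?u' j \<in> sphere_tangent (V j) (?u j)"
    proof
      fix j
      have "\<forall>\<^sub>F s in nhds t. norm (v j s) = 1"
        using near by eventually_elim (use unit in \<open>auto simp: unit_sphere_def\<close>)
      then show "?u' j \<in> sphere_tangent (V j) (?u j)"
        using derivative_orthogonal_of_constant_norm[OF dv[rule_format]] u'V
        by (simp add: sphere_tangent_def)
    qed
    have "((\<lambda>s. T (\<lambda>j. v j s)) has_vector_derivative (\<Sum>j\<in>UNIV. T (?u(j := ?u' j)))) (at t)"
    proof (rule has_vector_derivative_tensor[OF tensor _ uV dv u'V], rule allI)
      fix j
      have "\<forall>\<^sub>F s in nhds t. v j s \<in> V j"
        using near by eventually_elim (use unit in \<open>auto simp: unit_sphere_def\<close>)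
      then show "\<forall>\<^sub>F s in at t. v j s \<in> V j"
        by (simp add: eventually_nhds_conv_at)
    qed
    from has_vector_derivative_scaleR[OF dl[folded has_real_derivative_iff_has_vector_derivative] this]
    have "((\<lambda>s. lam s *\<^sub>R T (\<lambda>j. v j s)) has_vector_derivative ?p) (at t)"
      by (simp only: add.commute)
    moreover have "\<And>s. s \<in> {0<..<\<epsilon>} \<Longrightarrow> lam s *\<^sub>R T (\<lambda>j. v j s) = v_r s"
      using assms(7) by simp
    ultimately have "(v_r has_vector_derivative ?p) (at t)"
      using has_vector_derivative_transform_within_open[of _ ?p t "{0<..<\<epsilon>}" v_r] t by auto
    then have velocity: "vector_derivative v_r (at t) = ?p"
      by (rule vector_derivative_at)
    have orth: "inner ?p x = inner (A (v_r t)) x" if "x \<in> hartree_tangent V T (lam t) ?u" for x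
    proof -
      have "inner (vector_derivative v_r (at t) - A (v_r t)) x = 0"
        using assms(14) t that unfolding is_orthogonal_projection_def by blast
      then show ?thesis
        by (simp only: velocity inner_diff_left right_minus_eq)
    qed
    \<comment> \<open>The domain is assumed to contain \<open>v_r t\<close>, not \<open>T ?u\<close>; dividing by \<open>lam t\<close> brings in the latter.\<close>
    have "T ?u = (1 / lam t) *\<^sub>R v_r t"
      using l vr by simp
    then have "T ?u \<in> D"
      using assms(2,13) t unfolding densely_defined_operator_def
      by (metis IntD2 subspace_scale)
    then have A: "A (v_r t) = lam t *\<^sub>R A (T ?u)"
      using assms(2) vr by (simp add: densely_defined_operator_def)
    have "?l' = ?a t * lam t"
      using orth[OF tensor_in_hartree_tangent(1)[OF tensor uV]] inner_velocity(1)[OF tensor u u'] A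
      by simp
    then have "(lam has_real_derivative ?a t * lam t) (at t)"
      using dl by (simp add: has_real_derivative_iff_has_vector_derivative)
    moreover have "inner (?u' k) w - bilinear_form_a A T v k t (v k t) w = 0"
      if w: "w \<in> sphere_tangent (V k) (v k t)" for k w
    proof -
      have "lam t * (lam t * inner (?u' k) w) = lam t * (lam t * inner (A (T ?u)) (T (?u(k := w))))"
        using orth[OF tensor_in_hartree_tangent(2)[OF tensor uV w]]
          inner_velocity(2)[OF tensor u u' w] A
        by simp
      then show ?thesis
        using l by (simp add: bilinear_form_a_def fun_upd_idem)
    qed
    ultimately show ?thesis
      using l by blast
  qed
  note interior = this
  have "?a integrable_on {0..t} \<and> lam t = lam0 * exp (integral {0..t} ?a)"
    if t: "t \<in> {0..<\<epsilon>}" for t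
  proof -
    have "continuous_on {0..t} lam"
      using t by (intro continuous_on_subset[OF assms(11)]) auto
    moreover have "\<forall>s\<in>{0..t}. lam s \<noteq> 0"
      using interior lam0 t by (metis atLeastAtMost_iff atLeastLessThan_iff greaterThanLessThan_iff
          le_less_trans order_le_less)
    moreover have "\<forall>s\<in>{0<..<t}. (lam has_real_derivative ?a s * lam s) (at s)"
      using interior t by auto
    ultimately show ?thesis
      using nonvanishing_solution_eq_exp_integral[of t lam ?a] t assms(16) by auto
  qed
  then show ?thesis
    using interior by blast
qed

end
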